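(* Let $T$ be a non-degenerate simplex in $\mathbb{R}^d$ with vertices ${\bf v}_0,{\bf v}_1,\ldots,{\bf v}_d$, circumcenter ${\bf c}$ and circumradius $R$. Then the function $$\mathcal E({\bf x})=\frac{R^2}{4}+|{\bf x}-\varphi({\bf x})|^2-\frac12|{\bf x}-{\bf c}|^2$$ is continuously differentiable on $\mathbb{R}^d$ with gradient $\nabla\mathcal E({\bf x})={\bf x}+{\bf c}-2\varphi({\bf x})$, ${\bf x}\in\mathbb{R}^d$. Furthermore, $$|\nabla\mathcal E({\bf x})-\nabla\mathcal E({\bf y})|\le|{\bf x}-{\bf y}|,\qquad {\bf x},{\bf y}\in\mathbb{R}^d,$$ and hence $\mathcal E\in W^2(\mathbb{R}^d)$. Finally, $\mathcal E({\bf v}_i)=0$ and $\nabla\mathcal E({\bf v}_i)={\bf 0}$ for $i=0,1,\ldots,d$.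
   Context: $|\cdot|$ is the Euclidean norm on $\mathbb{R}^d$. A simplex with $d+1$ vertices in $\mathbb{R}^d$ is non-degenerate if it is not contained in any $(d-1)$-dimensional hyperplane. The circumcenter ${\bf c}$ is the point equidistant from all vertices and $R=|{\bf c}-{\bf v}_i|$. Let $U=\frac12({\bf c}+T)=\{\frac12({\bf c}+{\bf t}):{\bf t}\in T\}$, the simplex with vertices $\frac12({\bf c}+{\bf v}_i)$, $i=0,\ldots,d$; $\varphi:\mathbb{R}^d\to U$ sends ${\bf x}$ to the unique point of $U$ closest to ${\bf x}$. $W^2_\infty[a,b]$ is the class of functions $g:[a,b]\to\mathbb{R}$ such that $g'$ is absolutely continuous on $[a,b]$ and $|g''(t)|\le1$ for a.e. $t\in[a,b]$ (equivalently, $g'$ exists everywhere on $[a,b]$ and $|g'(t_1)-g'(t_2)|\le|t_1-t_2|$ for all $t_1,t_2\in[a,b]$). $W^2(\mathbb{R}^d)$ is the class of $f\in C^1(\mathbb{R}^d)$ such that for any two distinct points ${\bf x},{\bf y}\in\mathbb{R}^d$, with $\rho=|{\bf y}-{\bf x}|$, the function $g(t)=f({\bf x}+\frac t\rho({\bf y}-{\bf x}))$, $t\in[0,\rho]$, belongs to $W^2_\infty[0,\rho]$. *)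

theory Defs
  imports "HOL-Analysis.Analysis"
begin

text \<open>The space of dimension \<open>d\<close> is a type \<open>'a\<close> of class \<open>euclidean_space\<close> with \<open>d = DIM('a)\<close>.
  A simplex is given by a family \<open>v\<close> whose members \<open>v 0, \<dots>, v DIM('a)\<close> are the vertices;
  values of \<open>v\<close> at larger indices are irrelevant.\<close>

definition simplex_of :: "(nat \<Rightarrow> 'a::euclidean_space) \<Rightarrow> 'a set" where
  "simplex_of v = convex hull (v ` {0..DIM('a)})"

definition nondegenerate :: "(nat \<Rightarrow> 'a::euclidean_space) \<Rightarrow> bool" where
  "nondegenerate v \<longleftrightarrow>
     \<not> (\<exists>H. affine H \<and> aff_dim H = int DIM('a) - 1 \<and> simplex_of v \<subseteq> H)"

definition circumcenter :: "(nat \<Rightarrow> 'a::euclidean_space) \<Rightarrow> 'a" where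
  "circumcenter v = (THE c. \<forall>i\<le>DIM('a). \<forall>j\<le>DIM('a). norm (c - v i) = norm (c - v j))"

text \<open>For a non-degenerate simplex the choice of the vertex \<open>v 0\<close> is immaterial,
  see \<open>circumradius\<close> below.\<close>

definition circumradius :: "(nat \<Rightarrow> 'a::euclidean_space) \<Rightarrow> real" where
  "circumradius v = norm (circumcenter v - v 0)"

definition half_simplex :: "(nat \<Rightarrow> 'a::euclidean_space) \<Rightarrow> 'a set" where
  "half_simplex v = (\<lambda>t. (1/2) *\<^sub>R (circumcenter v + t)) ` simplex_of v"

text \<open>\<open>half_simplex v\<close> is nonempty, compact and convex, so the closest point exists and is unique.\<close>

definition proj :: "(nat \<Rightarrow> 'a::euclidean_space) \<Rightarrow> 'a \<Rightarrow> 'a" where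
  "proj v x = closest_point (half_simplex v) x"

definition err_fun :: "(nat \<Rightarrow> 'a::euclidean_space) \<Rightarrow> 'a \<Rightarrow> real" where
  "err_fun v x = (circumradius v)\<^sup>2 / 4 + (norm (x - proj v x))\<^sup>2
                 - (1/2) * (norm (x - circumcenter v))\<^sup>2"

definition gradient :: "('a::euclidean_space \<Rightarrow> real) \<Rightarrow> 'a \<Rightarrow> 'a" where
  "gradient f x = (THE D. GDERIV f x :> D)"

definition continuously_differentiable :: "('a::euclidean_space \<Rightarrow> real) \<Rightarrow> bool" where
  "continuously_differentiable f \<longleftrightarrow>
     (\<exists>G. (\<forall>x. GDERIV f x :> G x) \<and> continuous_on UNIV G)"

definition abs_continuous_on_interval :: "real \<Rightarrow> real \<Rightarrow> (real \<Rightarrow> real) \<Rightarrow> bool" where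
  "abs_continuous_on_interval a b h \<longleftrightarrow>
     (\<forall>\<epsilon>>0. \<exists>\<delta>>0. \<forall>(n::nat) l r.
        (\<forall>k<n. a \<le> l k \<and> l k \<le> r k \<and> r k \<le> b) \<and>
        disjoint_family_on (\<lambda>k. {l k<..<r k}) {..<n} \<and>
        (\<Sum>k<n. r k - l k) < \<delta>
        \<longrightarrow> (\<Sum>k<n. \<bar>h (r k) - h (l k)\<bar>) < \<epsilon>)"

text \<open>A function on \<open>[a, b]\<close> is represented by a total function of which only the values on
  \<open>[a, b]\<close> matter; derivatives are taken within \<open>[a, b]\<close>, hence one-sided at the endpoints.\<close>

definition W2inf :: "real \<Rightarrow> real \<Rightarrow> (real \<Rightarrow> real) set" where
  "W2inf a b = {g. \<exists>g'.
     (\<forall>t\<in>{a..b}. (g has_real_derivative g' t) (at t within {a..b})) \<and>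
     abs_continuous_on_interval a b g' \<and>
     (AE t in lborel. t \<in> {a..b} \<longrightarrow>
        (\<exists>D. (g' has_real_derivative D) (at t within {a..b}) \<and> \<bar>D\<bar> \<le> 1))}"

definition W2 :: "('a::euclidean_space \<Rightarrow> real) set" where
  "W2 = {f. continuously_differentiable f \<and>
     (\<forall>x y. x \<noteq> y \<longrightarrow>
        (\<lambda>t. f (x + (t / norm (y - x)) *\<^sub>R (y - x))) \<in> W2inf 0 (norm (y - x)))}"

text \<open>The definite description in \<open>circumcenter\<close> is legitimate for non-degenerate simplices.\<close>

lemma nondegenerate_orthogonal:
  fixes v :: "nat \<Rightarrow> 'a::euclidean_space"
  assumes "nondegenerate v" and orth: "\<And>i. i \<le> DIM('a) \<Longrightarrow> z \<bullet> (v i - v 0) = 0"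
  shows "z = 0"
proof (rule ccontr)
  assume z: "z \<noteq> 0"
  let ?H = "{x. z \<bullet> x = z \<bullet> v 0}"
  have "v ` {0..DIM('a)} \<subseteq> ?H"
  proof (intro image_subsetI CollectI)
    fix i assume "i \<in> {0..DIM('a)}"
    then have "z \<bullet> (v i - v 0) = 0" by (intro orth) simp
    then show "z \<bullet> v i = z \<bullet> v 0" by (simp only: inner_diff_right right_minus_eq)
  qed
  then have "simplex_of v \<subseteq> ?H"
    unfolding simplex_of_def by (intro hull_minimal convex_hyperplane)
  moreover have "affine ?H" by (rule affine_hyperplane)
  moreover have "aff_dim ?H = int DIM('a) - 1"
    using aff_dim_hyperplane[OF z, of "z \<bullet> v 0"] by (simp add: of_nat_diff)
  ultimately show False using assms(1) unfolding nondegenerate_def by blast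
qed

lemma equidistant_iff:
  fixes c p q :: "'a::euclidean_space"
  shows "norm (c - p) = norm (c - q) \<longleftrightarrow> 2 * (c \<bullet> (p - q)) = p \<bullet> p - q \<bullet> q"
  by (simp add: norm_eq_sqrt_inner inner_diff_left inner_diff_right
      inner_commute[of p c] inner_commute[of q c]) linarith

lemma circumcenter_ex1:
  fixes v :: "nat \<Rightarrow> 'a::euclidean_space"
  assumes nd: "nondegenerate v"
  shows "\<exists>!c. \<forall>i\<le>DIM('a). \<forall>j\<le>DIM('a). norm (c - v i) = norm (c - v j)"
proof (rule ex_ex1I)
  obtain h where h: "bij_betw h (Basis :: 'a set) {1..DIM('a)}"
    using finite_same_card_bij[of "Basis :: 'a set" "{1..DIM('a)}"] by auto
  define L where "L x = (\<Sum>b\<in>Basis. (x \<bullet> (v (h b) - v 0)) *\<^sub>R b)" for x :: 'a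
  have L: "L x \<bullet> b = x \<bullet> (v (h b) - v 0)" if "b \<in> Basis" for x b
    using that unfolding L_def by simp
  have lin: "linear L"
    unfolding L_def
    by (intro linearI)
       (simp_all add: inner_add_left scaleR_add_left sum.distrib scaleR_sum_right)
  have "inj L"
  proof (subst linear_injective_0[OF lin], intro allI impI)
    fix z assume "L z = 0"
    then have 0: "z \<bullet> (v (h b) - v 0) = 0" if "b \<in> Basis" for b
      using L[OF that, of z] by simp
    have "z \<bullet> (v i - v 0) = 0" if "i \<le> DIM('a)" for i
    proof (cases "i = 0")
      case False
      then have "i \<in> h ` Basis" using h that by (auto simp: bij_betw_def)
      then show ?thesis using 0 by blast
    qed simp
    then show "z = 0" using nondegenerate_orthogonal[OF nd] by blast
  qed
  then have "surj L" using lin linear_injective_imp_surjective by blast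
  then obtain c where c: "L c = (\<Sum>b\<in>Basis. ((v (h b) \<bullet> v (h b) - v 0 \<bullet> v 0) / 2) *\<^sub>R b)"
    by (elim surjE[where y = "\<Sum>b\<in>Basis. ((v (h b) \<bullet> v (h b) - v 0 \<bullet> v 0) / 2) *\<^sub>R b"]) simp
  have c': "norm (c - v i) = norm (c - v 0)" if "i \<le> DIM('a)" for i
  proof (cases "i = 0")
    case False
    then have "i \<in> h ` Basis" using h that by (auto simp: bij_betw_def)
    then obtain b where b: "b \<in> Basis" "i = h b" by blast
    have "c \<bullet> (v i - v 0) = (v i \<bullet> v i - v 0 \<bullet> v 0) / 2"
      using L[OF b(1), of c] b unfolding c by simp
    then show ?thesis by (simp add: equidistant_iff)
  qed simp
  then show "\<exists>c. \<forall>i\<le>DIM('a). \<forall>j\<le>DIM('a). norm (c - v i) = norm (c - v j)"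
    by (intro exI[of _ c] allI impI) (rule trans[OF c' c'[symmetric]])
next
  fix c c'
  assume "\<forall>i\<le>DIM('a). \<forall>j\<le>DIM('a). norm (c - v i) = norm (c - v j)"
    and "\<forall>i\<le>DIM('a). \<forall>j\<le>DIM('a). norm (c' - v i) = norm (c' - v j)"
  then have "norm (c - v i) = norm (c - v 0)" "norm (c' - v i) = norm (c' - v 0)"
    if "i \<le> DIM('a)" for i
    using that by blast+
  then have "2 * (c \<bullet> (v i - v 0)) = v i \<bullet> v i - v 0 \<bullet> v 0"
      "2 * (c' \<bullet> (v i - v 0)) = v i \<bullet> v i - v 0 \<bullet> v 0" if "i \<le> DIM('a)" for i
    using that by (simp_all only: equidistant_iff)
  then have "c \<bullet> (v i - v 0) = c' \<bullet> (v i - v 0)" if "i \<le> DIM('a)" for i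
    using that by fastforce
  then have "(c - c') \<bullet> (v i - v 0) = 0" if "i \<le> DIM('a)" for i
    using that by (simp add: inner_diff_left)
  then have "c - c' = 0" by (rule nondegenerate_orthogonal[OF nd])
  then show "c = c'" by simp
qed

lemma circumradius:
  fixes v :: "nat \<Rightarrow> 'a::euclidean_space"
  assumes "nondegenerate v" and "i \<le> DIM('a)"
  shows "norm (circumcenter v - v i) = circumradius v"
proof -
  have "\<forall>i\<le>DIM('a). \<forall>j\<le>DIM('a).
      norm (circumcenter v - v i) = norm (circumcenter v - v j)"
    unfolding circumcenter_def by (rule theI'[OF circumcenter_ex1[OF assms(1)]])
  from this[rule_format, OF assms(2) le0] show ?thesis
    unfolding circumradius_def .
qed

end

theory Submission
  imports Defs
begin

text \<open>Let \<open>P\<close> be the projection onto \<open>U\<close>. Up to a constant, \<open>\<E>\<close> is the squared distance to \<open>U\<close>,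
  with gradient \<open>2 (x - P x)\<close>, minus half the squared distance to \<open>c\<close>. Firm nonexpansiveness of \<open>P\<close>
  makes \<open>\<nabla>\<E>\<close> 1-Lipschitz. The almost everywhere existence of second derivatives along a line needs no
  Rademacher theorem: the set of parameters whose projection lies in the relative interior of a
  given face is an interval on which \<open>P\<close> is affine, and there are finitely many faces. Finally,
  \<open>v\<^sub>i\<close> maximises the functional \<open>(v\<^sub>i - c) \<bullet> _\<close> over \<open>T\<close> because all vertices lie on a sphere
  about \<open>c\<close>, so \<open>P v\<^sub>i = (c + v\<^sub>i) / 2\<close>.\<close>

section \<open>Closest points in closed convex sets\<close>

text \<open>Add the obtuse-angle inequalities at the two projections, each tested against the other
  projection.\<close>

lemma closest_point_firmly_nonexpansive:
  fixes S :: "'a::euclidean_space set"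
  assumes "convex S" "closed S" "S \<noteq> {}"
  shows "(norm (closest_point S x - closest_point S y))\<^sup>2
    \<le> (x - y) \<bullet> (closest_point S x - closest_point S y)"
proof -
  have "(x - closest_point S x) \<bullet> (closest_point S y - closest_point S x) \<le> 0"
    "(y - closest_point S y) \<bullet> (closest_point S x - closest_point S y) \<le> 0"
    using assms by (auto intro!: closest_point_dot closest_point_in_set)
  then show ?thesis
    by (simp add: power2_norm_eq_inner inner_diff_left inner_diff_right inner_commute)
qed

text \<open>The obtuse-angle condition characterises the closest point: two points of
  \<open>S\<close> that both satisfy it, tested against each other, have squared distance at most
  0.\<close>

lemma closest_point_eqI:
  fixes S :: "'a::euclidean_space set"
  assumes "convex S" "closed S" "p \<in> S" and obtuse: "\<And>z. z \<in> S \<Longrightarrow> (x - p) \<bullet> (z - p) \<le> 0"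
  shows "closest_point S x = p"
proof -
  define q where "q = closest_point S x"
  have "q \<in> S" using assms closest_point_in_set unfolding q_def by blast
  then have "(x - p) \<bullet> (q - p) \<le> 0" by (rule obtuse)
  moreover have "(x - q) \<bullet> (p - q) \<le> 0"
    using closest_point_dot[OF assms(1-3)] unfolding q_def .
  ultimately have "(q - p) \<bullet> (q - p) \<le> 0"
    by (simp add: inner_diff_left inner_diff_right inner_commute)
  then have "q - p = 0" by (metis inner_ge_zero inner_eq_zero_iff order_antisym)
  then show ?thesis by (simp add: q_def)
qed

text \<open>Reduces differentiability of squared distances to an algebraic estimate of the
  remainder.\<close>

lemma quadratic_remainder_imp_GDERIV:
  fixes f :: "'a::euclidean_space \<Rightarrow> real"
  assumes "\<And>y. \<bar>f y - f x - (y - x) \<bullet> D\<bar> \<le> C * (norm (y - x))\<^sup>2"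
  shows "GDERIV f x :> D"
  unfolding gderiv_def
proof (rule has_derivativeI_sandwich[of 1])
  show "bounded_linear (\<lambda>h. h \<bullet> D)" by (rule bounded_linear_inner_left)
  show "((\<lambda>y. C * norm (y - x)) \<longlongrightarrow> 0) (at x)" by (auto intro!: tendsto_eq_intros)
  fix y assume "y \<noteq> x"
  then show "norm (f y - f x - (y - x) \<bullet> D) / norm (y - x) \<le> C * norm (y - x)"
    using assms[of y] by (simp add: pos_divide_le_eq power2_eq_square mult.assoc)
qed simp

lemma GDERIV_dist_closest_point_squared:
  fixes S :: "'a::euclidean_space set"
  assumes S: "convex S" "closed S" "S \<noteq> {}"
  shows "GDERIV (\<lambda>x. (norm (x - closest_point S x))\<^sup>2) x :> 2 *\<^sub>R (x - closest_point S x)"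
proof (rule quadratic_remainder_imp_GDERIV[where C = 1])
  fix y
  let ?P = "closest_point S"
  \<comment> \<open>Each projection competes in the other's minimisation. The two comparisons bound
    the remainder from above by \<open>(norm (y - x))\<^sup>2\<close> and from below by \<open>(norm
    (y - x))\<^sup>2 - 2 * ((y - x) \<bullet> (?P y - ?P x))\<close>.\<close>
  have upper: "(norm (b - ?P b))\<^sup>2 \<le> (norm (b - ?P a))\<^sup>2" for a b
    using closest_point_le[OF S(2) closest_point_in_set[OF S(2,3)], of b a]
    by (simp add: dist_norm)
  have "(y - x) \<bullet> (?P y - ?P x) \<le> norm (y - x) * norm (?P y - ?P x)"
    by (rule norm_cauchy_schwarz)
  also have "\<dots> \<le> (norm (y - x))\<^sup>2"
    using closest_point_lipschitz[OF S, of y x]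
    by (simp add: dist_norm power2_eq_square mult_left_mono)
  finally have "(y - x) \<bullet> (?P y - ?P x) \<le> (norm (y - x))\<^sup>2" .
  then show "\<bar>(norm (y - ?P y))\<^sup>2 - (norm (x - ?P x))\<^sup>2 - (y - x) \<bullet> (2 *\<^sub>R (x - ?P x))\<bar>
      \<le> 1 * (norm (y - x))\<^sup>2"
    using upper[of y x] upper[of x y]
    by (simp add: power2_norm_eq_inner inner_diff_left inner_diff_right inner_commute abs_le_iff)
qed

lemma gradient_eqI: "GDERIV f x :> D \<Longrightarrow> gradient f x = D"
  unfolding gradient_def
proof (rule the_equality)
  fix D' assume "GDERIV f x :> D" "GDERIV f x :> D'"
  then have "(\<lambda>h. h \<bullet> D) = (\<lambda>h. h \<bullet> D')"
    unfolding gderiv_def by (rule has_derivative_unique)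
  then show "D' = D" by (metis inner_commute vector_eq_ldot)
qed

section \<open>Faces of a polytope and regularity along lines\<close>

text \<open>A point off the relative interior lies in a proper face, which has smaller dimension;
  descend.\<close>

lemma polytope_rel_interior_face:
  fixes S :: "'a::euclidean_space set"
  assumes "polytope S" "p \<in> S"
  shows "\<exists>F. F face_of S \<and> p \<in> rel_interior F"
  using assms
\<comment> \<open>The shift by 1 prevents truncation by \<open>nat\<close>, since
  \<open>aff_dim\<close> is at least -1.\<close>
proof (induction "nat (aff_dim S + 1)" arbitrary: S rule: less_induct)
  case less
  note S = less.prems(1)
  have "convex S" "closed S"
    using S by (auto simp: polytope_imp_convex polytope_imp_closed)
  show ?case
  proof (cases "p \<in> rel_interior S")
    case True
    then show ?thesis using face_of_refl[OF \<open>convex S\<close>] by blast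
  next
    case False
    then have "p \<in> rel_frontier S"
      using less.prems \<open>closed S\<close> by (simp add: rel_frontier_def)
    then have "p \<in> \<Union>{F. F face_of S \<and> F \<noteq> S}"
      by (simp only: rel_frontier_of_polyhedron_alt[OF polytope_imp_polyhedron[OF S]])
    then obtain G where G: "G face_of S" "G \<noteq> S" "p \<in> G" by auto
    have "aff_dim G < aff_dim S" by (rule face_of_aff_dim_lt[OF \<open>convex S\<close> G(1,2)])
    then have "nat (aff_dim G + 1) < nat (aff_dim S + 1)"
      using aff_dim_geq[of G] by simp
    from less.hyps[OF this face_of_polytope_polytope[OF S G(1)] G(3)]
    show ?thesis using face_of_trans[OF _ G(1)] by blast
  qed
qed

text \<open>Over the relative interior of a convex subset \<open>F\<close>, the residual \<open>x - p\<close> is orthogonal to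
  \<open>F\<close>; hence the normal cones at all such points coincide and the projection is affine there.\<close>

lemma closest_point_rel_interior_affine:
  fixes S :: "'a::euclidean_space set"
  assumes S: "convex S" "closed S" and F: "convex F" "F \<subseteq> S"
    and x: "closest_point S x \<in> rel_interior F" and y: "closest_point S y \<in> rel_interior F"
    and l: "0 \<le> l" "l \<le> (1::real)"
  shows "closest_point S ((1 - l) *\<^sub>R x + l *\<^sub>R y)
    = (1 - l) *\<^sub>R closest_point S x + l *\<^sub>R closest_point S y"
proof -
  \<comment> \<open>The segment from \<open>q\<close> through the projection can be prolonged within
    \<open>F\<close>, so the obtuse-angle inequality holds in both directions and is an
    equality.\<close>
  have orth: "(a - closest_point S a) \<bullet> (q - closest_point S a) = 0"
    if a: "closest_point S a \<in> rel_interior F" and q: "q \<in> F" for a q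
  proof -
    let ?p = "closest_point S a"
    obtain e where e: "e > 1" "(1 - e) *\<^sub>R q + e *\<^sub>R ?p \<in> F"
      using convex_rel_interior_if2[OF F(1) a] hull_inc[OF q] by blast
    then have "(a - ?p) \<bullet> (((1 - e) *\<^sub>R q + e *\<^sub>R ?p) - ?p) \<le> 0"
      using closest_point_dot[OF S] F(2) by blast
    moreover have "((1 - e) *\<^sub>R q + e *\<^sub>R ?p) - ?p = (1 - e) *\<^sub>R (q - ?p)"
      by (simp add: algebra_simps)
    ultimately have "(1 - e) * ((a - ?p) \<bullet> (q - ?p)) \<le> 0" by simp
    then have "(a - ?p) \<bullet> (q - ?p) \<ge> 0" using e(1) by (simp add: mult_le_0_iff)
    moreover have "(a - ?p) \<bullet> (q - ?p) \<le> 0" using closest_point_dot[OF S] F(2) q by blast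
    ultimately show ?thesis by simp
  qed
  define p q where "p = closest_point S x" and "q = closest_point S y"
  have pq: "p \<in> F" "q \<in> F" using x y rel_interior_subset unfolding p_def q_def by blast+
  have 1: "(x - p) \<bullet> (q - p) = 0" and 2: "(y - q) \<bullet> (p - q) = 0"
    using orth[OF x pq(2)] orth[OF y pq(1)] by (simp_all add: p_def q_def)
  show ?thesis
    unfolding p_def[symmetric] q_def[symmetric]
  proof (rule closest_point_eqI[OF S])
    show "(1 - l) *\<^sub>R p + l *\<^sub>R q \<in> S"
      using S(1) pq F(2) l by (auto intro!: convexD)
    fix z assume z: "z \<in> S"
    have 3: "(x - p) \<bullet> (z - p) \<le> 0" "(y - q) \<bullet> (z - q) \<le> 0"
      unfolding p_def q_def using closest_point_dot[OF S z] by auto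
    let ?r = "(1 - l) *\<^sub>R p + l *\<^sub>R q"
    \<comment> \<open>By orthogonality, replacing the base point \<open>p\<close> or
      \<open>q\<close> by \<open>?r\<close> leaves both inequalities intact; their convex
      combination is the required one.\<close>
    have "(x - p) \<bullet> (z - ?r) = (x - p) \<bullet> (z - p) - l * ((x - p) \<bullet> (q - p))"
      by (simp add: algebra_simps)
    moreover have "(y - q) \<bullet> (z - ?r) = (y - q) \<bullet> (z - q) - (1 - l) * ((y - q) \<bullet> (p - q))"
      by (simp add: algebra_simps)
    ultimately have "(x - p) \<bullet> (z - ?r) \<le> 0" "(y - q) \<bullet> (z - ?r) \<le> 0"
      using 1 2 3 by auto
    then have "(1 - l) * ((x - p) \<bullet> (z - ?r)) + l * ((y - q) \<bullet> (z - ?r)) \<le> 0"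
      using l by (intro add_nonpos_nonpos) (auto simp: mult_nonneg_nonpos)
    moreover have "(1 - l) *\<^sub>R x + l *\<^sub>R y - ?r = (1 - l) *\<^sub>R (x - p) + l *\<^sub>R (y - q)"
      by (simp add: algebra_simps)
    ultimately show "((1 - l) *\<^sub>R x + l *\<^sub>R y - ?r) \<bullet> (z - ?r) \<le> 0"
      by (simp only: inner_add_left inner_scaleR_left)
  qed
qed

text \<open>The exceptional parameters lie on the frontiers of the finitely many convex sets
  \<open>I F\<close>; every other parameter is interior to some \<open>I F\<close>.\<close>

lemma AE_closest_point_locally_affine_on_line:
  fixes S :: "'a::euclidean_space set"
  assumes S: "polytope S" "S \<noteq> {}"
  shows "AE t in lborel. \<exists>e>0. \<exists>w. \<forall>s::real. \<bar>s - t\<bar> \<le> e \<longrightarrow>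
    closest_point S (x + s *\<^sub>R u) = closest_point S (x + t *\<^sub>R u) + (s - t) *\<^sub>R w"
proof -
  have S': "convex S" "closed S"
    using S by (auto simp: polytope_imp_convex polytope_imp_closed)
  define h where "h s = closest_point S (x + s *\<^sub>R u)" for s
  define I where "I F = {s. h s \<in> rel_interior F}" for F
  have aff: "h ((1 - l) * s + l * t) = (1 - l) *\<^sub>R h s + l *\<^sub>R h t"
    if F: "F face_of S" and "s \<in> I F" "t \<in> I F" "0 \<le> l" "l \<le> 1" for F s t l
  proof -
    have "x + ((1 - l) * s + l * t) *\<^sub>R u = (1 - l) *\<^sub>R (x + s *\<^sub>R u) + l *\<^sub>R (x + t *\<^sub>R u)"
      by (simp add: algebra_simps)
    then show ?thesis
      using closest_point_rel_interior_affine[OF S' face_of_imp_convex[OF F] face_of_imp_subset[OF F]]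
        that by (simp add: h_def I_def)
  qed
  have conv: "convex (I F)" if F: "F face_of S" for F
    unfolding convex_alt
  proof (intro ballI allI impI)
    fix s t l assume *: "s \<in> I F" "t \<in> I F" "0 \<le> l \<and> l \<le> (1::real)"
    have "(1 - l) *\<^sub>R h s + l *\<^sub>R h t \<in> rel_interior F"
      using * convex_rel_interior[OF face_of_imp_convex[OF F]]
      unfolding I_def convex_alt by blast
    then show "(1 - l) *\<^sub>R s + l *\<^sub>R t \<in> I F"
      using aff[OF F, of s t l] * by (simp add: I_def)
  qed
  let ?N = "\<Union>F\<in>{F. F face_of S}. frontier (I F)"
  have "negligible ?N"
    by (intro negligible_Union) (auto simp: finite_polytope_faces S negligible_convex_frontier conv)
  then have "?N \<in> null_sets lebesgue" by (simp add: negligible_iff_null_sets)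
  then have "AE t in lebesgue. t \<notin> ?N" by (rule AE_not_in)
  then have "AE t in lborel. t \<notin> ?N" by (simp only: AE_completion_iff)
  then show ?thesis
  proof (rule AE_mp, intro AE_I2 impI)
    fix t assume t: "t \<notin> ?N"
    have "h t \<in> S" unfolding h_def using S S' by (intro closest_point_in_set)
    then obtain F where F: "F face_of S" "h t \<in> rel_interior F"
      using polytope_rel_interior_face S by blast
    then have "t \<in> interior (I F)"
      using t closure_subset[of "I F"] by (auto simp: I_def frontier_def)
    then obtain e where e: "e > 0" "cball t e \<subseteq> I F" by (auto simp: mem_interior_cball)
    \<comment> \<open>The slope of the chord of \<open>h\<close> over the interval from
      \<open>t - e\<close> to \<open>t + e\<close>.\<close>
    define w where "w = (1 / (2 * e)) *\<^sub>R (h (t + e) - h (t - e))"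
    have I: "t - e \<in> I F" "t + e \<in> I F" using e by (auto simp: subset_iff dist_real_def)
    have w: "h s = h (t - e) + (s - (t - e)) *\<^sub>R w" if "\<bar>s - t\<bar> \<le> e" for s
    proof -
      define l where "l = (s - (t - e)) / (2 * e)"
      have l: "0 \<le> l" "l \<le> 1" "2 * e * l = s - (t - e)"
        using that e(1) by (auto simp: l_def field_simps abs_le_iff)
      have "(1 - l) * (t - e) + l * (t + e) = s" using l(3) by (simp add: algebra_simps)
      then have "h s = (1 - l) *\<^sub>R h (t - e) + l *\<^sub>R h (t + e)"
        using aff[OF F(1) I l(1,2)] by simp
      also have "\<dots> = h (t - e) + l *\<^sub>R (h (t + e) - h (t - e))" by (simp add: algebra_simps)
      also have "l *\<^sub>R (h (t + e) - h (t - e)) = (s - (t - e)) *\<^sub>R w"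
        unfolding w_def l_def by simp
      finally show ?thesis .
    qed
    have "h s = h t + (s - t) *\<^sub>R w" if "\<bar>s - t\<bar> \<le> e" for s
      using w[OF that] w[of t] e(1) by (simp add: algebra_simps)
    then show "\<exists>e>0. \<exists>w. \<forall>s::real. \<bar>s - t\<bar> \<le> e \<longrightarrow>
        closest_point S (x + s *\<^sub>R u) = closest_point S (x + t *\<^sub>R u) + (s - t) *\<^sub>R w"
      using e(1) unfolding h_def by blast
  qed
qed

lemma abs_continuous_on_interval_lipschitz:
  assumes lip: "\<And>s t. \<bar>h s - h t\<bar> \<le> \<bar>s - t\<bar>"
  shows "abs_continuous_on_interval a b h"
  unfolding abs_continuous_on_interval_def
proof (intro allI impI)
  fix e :: real assume "e > 0"
  \<comment> \<open>Increments are at most the interval lengths, so \<open>e\<close> itself serves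
    as the threshold for the total length.\<close>
  have "(\<Sum>k<n. \<bar>h (r k) - h (l k)\<bar>) < e"
    if "\<forall>k<n. a \<le> l k \<and> l k \<le> r k \<and> r k \<le> b" "(\<Sum>k<n. r k - l k) < e" for n l r
  proof -
    have "\<bar>h (r k) - h (l k)\<bar> \<le> r k - l k" if "k < n" for k
      using lip[of "r k" "l k"] \<open>\<forall>k<n. _ k\<close> that by force
    then have "(\<Sum>k<n. \<bar>h (r k) - h (l k)\<bar>) \<le> (\<Sum>k<n. r k - l k)" by (intro sum_mono) simp
    then show ?thesis using that(2) by simp
  qed
  then show "\<exists>d>0. \<forall>(n::nat) l r. (\<forall>k<n. a \<le> l k \<and> l k \<le> r k \<and> r k \<le> b) \<and>
      disjoint_family_on (\<lambda>k. {l k<..<r k}) {..<n} \<and> (\<Sum>k<n. r k - l k) < d \<longrightarrow>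
      (\<Sum>k<n. \<bar>h (r k) - h (l k)\<bar>) < e"
    using \<open>e > 0\<close> by blast
qed

section \<open>The half simplex and the projections of the vertices\<close>

lemma polytope_half_simplex: "polytope (half_simplex v)"
proof -
  have "half_simplex v = (\<lambda>t. (1/2) *\<^sub>R circumcenter v + (1/2) *\<^sub>R t) ` simplex_of v"
    by (simp add: half_simplex_def scaleR_add_right)
  also have "\<dots> = (+) ((1/2) *\<^sub>R circumcenter v) ` (\<lambda>t. (1/2) *\<^sub>R t) ` simplex_of v"
    by (simp add: image_image)
  finally show ?thesis
    by (simp add: polytope_translation_eq polytope_scaling simplex_of_def polytope_convex_hull)
qed

lemma half_simplex_convex_closed_nonempty:
  "convex (half_simplex v)" "closed (half_simplex v)" "half_simplex v \<noteq> {}"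
  using polytope_half_simplex[of v]
  by (auto simp: polytope_imp_convex polytope_imp_closed half_simplex_def simplex_of_def)

text \<open>At a vertex this is the residual of the projection: its direction proves
  \<open>proj_vertex\<close>, its length gives the value of \<open>err_fun\<close>.\<close>

lemma diff_midpoint: "x - (1/2) *\<^sub>R (c + x) = (1/2) *\<^sub>R (x - c)" for x c :: "'a::real_vector"
proof -
  have "x - (1/2) *\<^sub>R (c + x) = (1/2) *\<^sub>R (x + x) - (1/2) *\<^sub>R (c + x)"
    by (simp only: scaleR_half_double)
  also have "\<dots> = (1/2) *\<^sub>R (x - c)"
    by (simp only: add_diff_cancel_right flip: scaleR_diff_right)
  finally show ?thesis .
qed

lemma proj_vertex:
  fixes v :: "nat \<Rightarrow> 'a::euclidean_space"
  assumes nd: "nondegenerate v" and i: "i \<le> DIM('a)"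
  shows "proj v (v i) = (1/2) *\<^sub>R (circumcenter v + v i)"
  unfolding proj_def
proof (rule closest_point_eqI[OF half_simplex_convex_closed_nonempty(1,2)])
  let ?c = "circumcenter v"
  have "v i \<in> simplex_of v" unfolding simplex_of_def using i by (intro hull_inc) auto
  then show "(1/2) *\<^sub>R (?c + v i) \<in> half_simplex v" unfolding half_simplex_def by blast
  have "v ` {0..DIM('a)} \<subseteq> {z. (v i - ?c) \<bullet> z \<le> (v i - ?c) \<bullet> v i}"
  proof safe
    fix j assume "j \<in> {0..DIM('a)}"
    then have "norm (v j - ?c) = norm (v i - ?c)"
      using circumradius[OF nd] i by (simp add: norm_minus_commute)
    \<comment> \<open>Cauchy-Schwarz: both vectors have length
      \<open>circumradius v\<close>.\<close>
    then have "(v i - ?c) \<bullet> (v j - ?c) \<le> (v i - ?c) \<bullet> (v i - ?c)"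
      using norm_cauchy_schwarz[of "v i - ?c" "v j - ?c"] by (simp add: norm_eq_sqrt_inner)
    then show "(v i - ?c) \<bullet> v j \<le> (v i - ?c) \<bullet> v i"
      by (simp add: inner_diff_right)
  qed
  then have "simplex_of v \<subseteq> {z. (v i - ?c) \<bullet> z \<le> (v i - ?c) \<bullet> v i}"
    unfolding simplex_of_def by (intro hull_minimal convex_halfspace_le)
  moreover fix z assume "z \<in> half_simplex v"
  ultimately obtain t where t: "z = (1/2) *\<^sub>R (?c + t)" "(v i - ?c) \<bullet> t \<le> (v i - ?c) \<bullet> v i"
    unfolding half_simplex_def by blast
  have "v i - (1/2) *\<^sub>R (?c + v i) = (1/2) *\<^sub>R (v i - ?c)"
    by (rule diff_midpoint)
  moreover have "z - (1/2) *\<^sub>R (?c + v i) = (1/2) *\<^sub>R (t - v i)"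
    by (simp add: t(1) algebra_simps)
  ultimately show "(v i - (1/2) *\<^sub>R (?c + v i)) \<bullet> (z - (1/2) *\<^sub>R (?c + v i)) \<le> 0"
    using t(2) by (simp add: inner_diff_right)
qed

section \<open>The gradient of the error function\<close>

lemma GDERIV_err_fun: "GDERIV (err_fun v) x :> x + circumcenter v - 2 *\<^sub>R proj v x"
proof -
  let ?c = "circumcenter v"
  have "(norm (y - ?c))\<^sup>2 - (norm (x - ?c))\<^sup>2 - (y - x) \<bullet> (2 *\<^sub>R (x - ?c)) = (norm (y - x))\<^sup>2" for y
    by (simp add: power2_norm_eq_inner inner_diff_left inner_diff_right inner_commute)
  then have "GDERIV (\<lambda>x. (norm (x - ?c))\<^sup>2) x :> 2 *\<^sub>R (x - ?c)"
    by (intro quadratic_remainder_imp_GDERIV[where C = 1]) simp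
  moreover have "GDERIV (\<lambda>x. (norm (x - proj v x))\<^sup>2) x :> 2 *\<^sub>R (x - proj v x)"
    unfolding proj_def by (rule GDERIV_dist_closest_point_squared[OF half_simplex_convex_closed_nonempty])
  \<comment> \<open>Written in the shape the sum and product rules produce; the zeros are the
    gradients of constants.\<close>
  ultimately have "GDERIV (err_fun v) x :>
      0 + 2 *\<^sub>R (x - proj v x) - ((1/2) *\<^sub>R (2 *\<^sub>R (x - ?c)) + (norm (x - ?c))\<^sup>2 *\<^sub>R 0)"
    unfolding err_fun_def by (intro GDERIV_diff GDERIV_add GDERIV_mult GDERIV_const)
  moreover have "0 + 2 *\<^sub>R (x - proj v x) - ((1/2) *\<^sub>R (2 *\<^sub>R (x - ?c)) + (norm (x - ?c))\<^sup>2 *\<^sub>R 0)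
      = x + ?c - 2 *\<^sub>R proj v x"
    by simp (simp add: algebra_simps scaleR_2)
  ultimately show ?thesis by metis
qed

lemma gradient_err_fun: "gradient (err_fun v) x = x + circumcenter v - 2 *\<^sub>R proj v x"
  by (rule gradient_eqI[OF GDERIV_err_fun])

text \<open>Firm nonexpansiveness of the projection \<open>P\<close> says exactly that the reflection
  \<open>id - 2 P\<close> is nonexpansive.\<close>

lemma gradient_err_fun_nonexpansive:
  "norm (gradient (err_fun v) x - gradient (err_fun v) y) \<le> norm (x - y)"
proof -
  let ?p = "proj v x - proj v y"
  have "?p \<bullet> ?p \<le> (x - y) \<bullet> ?p"
    using closest_point_firmly_nonexpansive[OF half_simplex_convex_closed_nonempty, of v x y]
    by (simp add: proj_def power2_norm_eq_inner)
  moreover have "gradient (err_fun v) x - gradient (err_fun v) y = (x - y) - 2 *\<^sub>R ?p"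
    by (simp add: gradient_err_fun algebra_simps)
  \<comment> \<open>The bracket subtracted on the right is nonnegative by firm
    nonexpansiveness.\<close>
  moreover have "((x - y) - 2 *\<^sub>R ?p) \<bullet> ((x - y) - 2 *\<^sub>R ?p)
      = (x - y) \<bullet> (x - y) - 4 * ((x - y) \<bullet> ?p - ?p \<bullet> ?p)"
    by (simp add: inner_diff_left[of "x - y"] inner_diff_right[of _ "x - y"]
        inner_commute[of ?p "x - y"] right_diff_distrib)
  ultimately show ?thesis by (simp add: norm_le)
qed

lemma continuously_differentiable_err_fun: "continuously_differentiable (err_fun v)"
  unfolding continuously_differentiable_def
proof (intro exI conjI allI)
  show "GDERIV (err_fun v) x :> x + circumcenter v - 2 *\<^sub>R proj v x" for x
    by (rule GDERIV_err_fun)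
  show "continuous_on UNIV (\<lambda>x. x + circumcenter v - 2 *\<^sub>R proj v x)"
    unfolding proj_def
    by (intro continuous_intros continuous_on_closest_point half_simplex_convex_closed_nonempty)
qed

section \<open>Second-order regularity on lines\<close>

text \<open>The directional derivative \<open>g\<close> inherits Lipschitz constant 1 because
  \<open>u\<close> is a unit vector, and it is affine near almost every parameter because the
  projection is.\<close>

lemma err_fun_on_line_in_W2inf:
  assumes u: "norm u = 1"
  shows "(\<lambda>t. err_fun v (x + t *\<^sub>R u)) \<in> W2inf a b"
proof -
  define g where "g t = gradient (err_fun v) (x + t *\<^sub>R u) \<bullet> u" for t
  have deriv: "((\<lambda>t. err_fun v (x + t *\<^sub>R u)) has_real_derivative g t) (at t within {a..b})" for t
  proof -
    have "(err_fun v has_derivative (\<lambda>h. h \<bullet> gradient (err_fun v) (x + t *\<^sub>R u))) (at (x + t *\<^sub>R u))"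
      using GDERIV_err_fun[of v] unfolding gderiv_def gradient_err_fun .
    moreover have "((\<lambda>t. x + t *\<^sub>R u) has_derivative (\<lambda>h. h *\<^sub>R u)) (at t within {a..b})"
      by (auto intro!: derivative_eq_intros)
    ultimately show ?thesis
      unfolding has_field_derivative_def
      by (auto intro: has_derivative_eq_rhs[OF has_derivative_compose]
          simp: g_def inner_commute mult.commute)
  qed
  have lip: "\<bar>g s - g t\<bar> \<le> \<bar>s - t\<bar>" for s t
  proof -
    let ?G = "\<lambda>t. gradient (err_fun v) (x + t *\<^sub>R u)"
    have "\<bar>g s - g t\<bar> \<le> norm (?G s - ?G t) * norm u"
      unfolding g_def inner_diff_left[symmetric] by (rule Cauchy_Schwarz_ineq2)
    also have "\<dots> \<le> norm ((x + s *\<^sub>R u) - (x + t *\<^sub>R u))"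
      unfolding u mult_1_right by (rule gradient_err_fun_nonexpansive)
    also have "\<dots> = \<bar>s - t\<bar>" using u by (simp flip: scaleR_diff_left)
    finally show ?thesis .
  qed
  have "AE t in lborel. \<exists>D. (g has_real_derivative D) (at t within {a..b}) \<and> \<bar>D\<bar> \<le> 1"
    using AE_closest_point_locally_affine_on_line
      [OF polytope_half_simplex half_simplex_convex_closed_nonempty(3), of v x u]
  proof (rule AE_mp, intro AE_I2 impI)
    fix t
    assume "\<exists>e>0. \<exists>w. \<forall>s::real. \<bar>s - t\<bar> \<le> e \<longrightarrow>
      closest_point (half_simplex v) (x + s *\<^sub>R u) =
      closest_point (half_simplex v) (x + t *\<^sub>R u) + (s - t) *\<^sub>R w"
    then obtain e w where e: "e > 0" and w: "\<And>s. \<bar>s - t\<bar> \<le> e \<Longrightarrow>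
      proj v (x + s *\<^sub>R u) = proj v (x + t *\<^sub>R u) + (s - t) *\<^sub>R w"
      unfolding proj_def by blast
    \<comment> \<open>Near \<open>t\<close> the gradient moves with constant velocity
      \<open>u - 2 *\<^sub>R w\<close>; its component along \<open>u\<close> is the slope of
      \<open>g\<close>.\<close>
    define D where "D = (u - 2 *\<^sub>R w) \<bullet> u"
    have g: "g s = g t + (s - t) * D" if "\<bar>s - t\<bar> \<le> e" for s
    proof -
      have "gradient (err_fun v) (x + s *\<^sub>R u)
          = gradient (err_fun v) (x + t *\<^sub>R u) + (s - t) *\<^sub>R (u - 2 *\<^sub>R w)"
        unfolding gradient_err_fun w[OF that] by (simp add: algebra_simps)
      then show ?thesis by (simp add: g_def D_def inner_add_left)
    qed
    \<comment> \<open>On the affine piece, an increment of \<open>e\<close> changes \<open>g\<close>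
      by exactly \<open>e * D\<close>, which the Lipschitz bound limits to \<open>e\<close>.\<close>
    have "\<bar>D\<bar> \<le> 1" using lip[of "t + e" t] g[of "t + e"] e by (simp add: abs_mult)
    moreover have "(g has_real_derivative D) (at t)"
    proof (rule DERIV_cong_ev[THEN iffD2, OF refl _ refl])
      show "\<forall>\<^sub>F s in nhds t. g s = g t + (s - t) * D"
        unfolding eventually_nhds_metric dist_real_def using e g less_imp_le by blast
      show "((\<lambda>s. g t + (s - t) * D) has_real_derivative D) (at t)"
        by (auto intro!: derivative_eq_intros)
    qed
    ultimately show "\<exists>D. (g has_real_derivative D) (at t within {a..b}) \<and> \<bar>D\<bar> \<le> 1"
      using has_field_derivative_at_within by blast
  qed
  then have "AE t in lborel. t \<in> {a..b} \<longrightarrow>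
      (\<exists>D. (g has_real_derivative D) (at t within {a..b}) \<and> \<bar>D\<bar> \<le> 1)"
    by (rule eventually_mono) simp
  then show ?thesis
    unfolding W2inf_def
    by (intro CollectI exI[of _ g] conjI ballI deriv abs_continuous_on_interval_lipschitz lip)
qed

lemma err_fun_in_W2: "err_fun v \<in> W2"
  unfolding W2_def
proof (intro CollectI conjI allI impI continuously_differentiable_err_fun)
  fix x y :: 'a assume "x \<noteq> y"
  then have "norm ((1 / norm (y - x)) *\<^sub>R (y - x)) = 1" by simp
  from err_fun_on_line_in_W2inf[OF this, of v x 0 "norm (y - x)"]
  show "(\<lambda>t. err_fun v (x + (t / norm (y - x)) *\<^sub>R (y - x))) \<in> W2inf 0 (norm (y - x))"
    by simp
qed

theorem theorem4p3:
  fixes v :: "nat \<Rightarrow> 'a::euclidean_space"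
  assumes "nondegenerate v"
  shows "continuously_differentiable (err_fun v)
    \<and> (\<forall>x. GDERIV (err_fun v) x :> x + circumcenter v - 2 *\<^sub>R proj v x)
    \<and> (\<forall>x y. norm (gradient (err_fun v) x - gradient (err_fun v) y) \<le> norm (x - y))
    \<and> err_fun v \<in> W2
    \<and> (\<forall>i\<le>DIM('a). err_fun v (v i) = 0 \<and> gradient (err_fun v) (v i) = 0)"
proof (intro conjI allI impI)
  fix i assume i: "i \<le> DIM('a)"
  note P = proj_vertex[OF assms i]
  \<comment> \<open>With R = \<open>circumradius v\<close>, the residual has length R/2, so the
    value is R^2/4 + R^2/4 - R^2/2 = 0.\<close>
  have "v i - proj v (v i) = (1/2) *\<^sub>R (v i - circumcenter v)"
    unfolding P by (rule diff_midpoint)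
  then show "err_fun v (v i) = 0"
    using circumradius[OF assms i]
    by (simp add: err_fun_def norm_minus_commute power_divide)
  show "gradient (err_fun v) (v i) = 0"
    by (simp add: gradient_err_fun P)
qed (rule continuously_differentiable_err_fun GDERIV_err_fun
    gradient_err_fun_nonexpansive err_fun_in_W2)+

end
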